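(* Let $m\ge 2$, $\sigma_0\in\{-1,+1\}$, $\tau>0$, real numbers $\alpha_0,\alpha_1,\dots,\alpha_{m-1}$ with $\alpha_0\ge 0$, and a real $(m-1)\times(m-1)$ signed permutation matrix $P$ be given. Consider the system $$D\,\partial_t q + \hat A\,\partial_x q = \hat B q,\qquad \hat A=\begin{bmatrix} (\alpha_1,\dots,\alpha_{m-1}) & \sigma_0\\ P & 0_{(m-1)\times 1}\end{bmatrix},\quad \hat B=\begin{bmatrix} -\alpha_0 & 0_{1\times(m-1)}\\ 0_{(m-1)\times 1} & P\end{bmatrix},$$ $D=\operatorname{diag}(1,\tau,\dots,\tau)$, i.e. $\partial_t q_0+\sum_{j=1}^{m-1}\alpha_j\partial_x q_{j-1}+\sigma_0\partial_x q_{m-1}=-\alpha_0 q_0$ and $\tau\partial_t q_i+\sum_{j}p_{ij}\partial_x q_{j-1}=\sum_j p_{ij}q_j$ for $i=1,\dots,m-1$. Then: (i) (stability at $k=0$) every $\omega\in\mathbb{C}$ with $\det(-i\omega D-\hat B)=0$ satisfies $\operatorname{Im}\omega\le 0$ if and only if $P=R-E$ with $R$ real skew-symmetric and $E$ diagonal with diagonal entries in $\{0,1\}$; (ii) (stability as $|k|\to\infty$) if $P=P^*$, then all eigenvalues of $\hat A$ are real, for every choice of real $\alpha_1,\dots,\alpha_{m-1}$.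
   Context: A real signed permutation matrix is a square matrix with all entries in $\{-1,0,+1\}$ having exactly one nonzero entry in each row and in each column. The matrix $P^*=(p^*_{ij})_{i,j=1}^{m-1}$ is defined by $p^*_{ij}=0$ if $i+j\ne m$, $p^*_{ij}=\sigma_0(-1)^{j-1}$ if $i+j=m$ and $j\le m/2$, and $p^*_{ij}=\sigma_0(-1)^{m-j}$ if $i+j=m$ and $j>m/2$. The system is a first-order relaxation of $u_t+\sum_{j=0}^{m-1}\alpha_j\partial_x^j u+\sigma_0\partial_x^m u=0$ with $q_j\approx\partial_x^j u$. The dispersion relation of the system is $\det(-i\omega D+ik\hat A-\hat B)=0$ (ansatz $q=\hat q e^{i(kx-\omega t)}$); stability at a wavenumber means all its roots $\omega$ satisfy $\operatorname{Im}\omega\le0$, and in the limit $|k|\to\infty$ this reduces to the requirement that $\hat A$ have only real eigenvalues. *)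

theory Defs
  imports "Jordan_Normal_Form.Char_Poly"
begin

text \<open>Matrices are JNF matrices with 0-based indices. Paper index i (1..m-1) of P
  corresponds to JNF index i-1; the system unknowns q_0..q_{m-1} are indices 0..m-1.\<close>

definition signed_perm_mat :: "nat \<Rightarrow> real mat \<Rightarrow> bool" where
  "signed_perm_mat n P \<longleftrightarrow> P \<in> carrier_mat n n
     \<and> (\<forall>i<n. \<forall>j<n. P $$ (i,j) \<in> {-1, 0, 1})
     \<and> (\<forall>i<n. \<exists>!j. j < n \<and> P $$ (i,j) \<noteq> 0)
     \<and> (\<forall>j<n. \<exists>!i. i < n \<and> P $$ (i,j) \<noteq> 0)"

definition A_hat :: "nat \<Rightarrow> real \<Rightarrow> (nat \<Rightarrow> real) \<Rightarrow> real mat \<Rightarrow> real mat" where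
  "A_hat m \<sigma>0 \<alpha> P = mat m m (\<lambda>(i,j).
     if i = 0 then (if j = m - 1 then \<sigma>0 else \<alpha> (j+1))
     else (if j = m - 1 then 0 else P $$ (i-1, j)))"

definition B_hat :: "nat \<Rightarrow> (nat \<Rightarrow> real) \<Rightarrow> real mat \<Rightarrow> real mat" where
  "B_hat m \<alpha> P = mat m m (\<lambda>(i,j).
     if i = 0 \<and> j = 0 then - \<alpha> 0
     else if i = 0 \<or> j = 0 then 0
     else P $$ (i-1, j-1))"

definition D_mat :: "nat \<Rightarrow> real \<Rightarrow> real mat" where
  "D_mat m \<tau> = mat m m (\<lambda>(i,j). if i = j then (if i = 0 then 1 else \<tau>) else 0)"

definition P_star :: "nat \<Rightarrow> real \<Rightarrow> real mat" where
  "P_star m \<sigma>0 = mat (m-1) (m-1) (\<lambda>(i',j').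
     let i = i' + 1; j = j' + 1 in
     if i + j \<noteq> m then 0
     else if 2 * j \<le> m then \<sigma>0 * (-1) ^ (j - 1)
     else \<sigma>0 * (-1) ^ (m - j))"

definition cmat :: "real mat \<Rightarrow> complex mat" where
  "cmat A = map_mat complex_of_real A"

end

theory Submission
  imports Defs "HOL-Combinatorics.Permutations"
begin

text \<open>At \<open>k = 0\<close> the system decouples, and stability says that every eigenvalue of \<open>P\<close> has
  nonpositive real part. A signed permutation is a direct sum of signed cycles; one of length \<open>l\<close>
  and sign \<open>s\<close> has as eigenvalues all solutions of \<open>x ^ l = s\<close>. These lie in the closed left half
  plane only if \<open>s = -1\<close> and \<open>l \<le> 2\<close>, which is the asserted form \<open>R - E\<close>; conversely
  \<open>Re (w\<^sup>* (R - E) w) = - w\<^sup>* E w \<le> 0\<close>.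

  For \<open>P = P\<^sup>*\<close> the equations \<open>p\<^sub>i x\<^bsub>m-1-i\<^esub> = z x\<^sub>i\<close> couple the inner components of an eigenvector
  of the matrix in pairs with \<open>p\<^sub>i = p\<^bsub>m-1-i\<^esub>\<close>, so \<open>z\<^sup>2 = 1\<close> unless all of them vanish, in which
  case \<open>z\<^sup>2 = \<alpha>\<^sub>1 z + 1\<close>.\<close>

section \<open>Signed cycles\<close>

text \<open>Weights are propagated backwards along the cycle through \<open>a\<close>: if
  \<open>j\<close> reaches \<open>a\<close> in \<open>k < l\<close> steps, its weight is the product
  of the signs met on the way divided by \<open>x ^ k\<close>. One step of \<open>\<pi>\<close>
  lowers \<open>k\<close> by one, and closing the cycle is exactly the equation \<open>root\<close>.
  Off the cycle \<open>w\<close> vanishes.\<close>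

lemma signed_cycle_eigenvector:
  fixes p :: "'a \<Rightarrow> 'b::field" and l :: nat
  assumes "inj \<pi>" and "l > 0" and cycle: "(\<pi> ^^ l) a = a"
    and minimal: "\<And>k. 0 < k \<Longrightarrow> k < l \<Longrightarrow> (\<pi> ^^ k) a \<noteq> a"
    and root: "x ^ l = (\<Prod>t<l. p ((\<pi> ^^ t) a))" and "x \<noteq> 0"
  obtains w :: "'a \<Rightarrow> 'b" where "w a = 1" and "\<And>j. p j * w (\<pi> j) = x * w j"
proof -
  define c where "c k j = (\<Prod>t<k. p ((\<pi> ^^ t) j))" for k j
  \<comment> \<open>Summing over all \<open>k < l\<close> avoids choosing the number of steps from
    \<open>j\<close> to \<open>a\<close>.\<close>
  define g where "g k j = (if (\<pi> ^^ k) j = a then c k j / x ^ k else 0)" for k j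
  define w where "w j = (\<Sum>k<l. g k j)" for j
  have step: "p j * g k (\<pi> j) = x * g (Suc k) j" for k j
  proof -
    have "c (Suc k) j = p j * c k (\<pi> j)"
      unfolding c_def by (subst prod.lessThan_Suc_shift) (simp add: funpow_swap1)
    then show ?thesis
      using \<open>x \<noteq> 0\<close> by (simp add: g_def funpow_swap1)
  qed
  \<comment> \<open>This makes the sum over \<open>k < l\<close> invariant under the index shift
    caused by \<open>step\<close>. At \<open>j = a\<close> it is the root equation; elsewhere both
    terms are zero, since by injectivity only \<open>a\<close> can reach \<open>a\<close> in
    \<open>l\<close> steps.\<close>
  have wrap: "g l j = g 0 j" for j
  proof (cases "j = a")
    case True
    then show ?thesis
      using cycle \<open>x \<noteq> 0\<close> by (simp add: g_def c_def flip: root)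
  next
    case False
    have "inj (\<pi> ^^ l)"
      using \<open>inj \<pi>\<close> by (rule inj_fn)
    with False cycle have "(\<pi> ^^ l) j \<noteq> a"
      by (metis injD)
    with False show ?thesis
      by (simp add: g_def)
  qed
  have "w a = (\<Sum>k<l. if k = 0 then 1 else 0)"
    unfolding w_def by (rule sum.cong) (auto simp: g_def c_def minimal)
  then have "w a = 1"
    using \<open>l > 0\<close> by simp
  moreover have "p j * w (\<pi> j) = x * w j" for j
  proof -
    have "p j * w (\<pi> j) = x * (\<Sum>k<l. g (Suc k) j)"
      by (simp add: w_def sum_distrib_left step)
    also have "(\<Sum>k<l. g (Suc k) j) = (\<Sum>k<Suc l. g k j) - g 0 j"
      by (subst sum.lessThan_Suc_shift) simp
    also have "\<dots> = w j"
      by (simp add: w_def wrap)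
    finally show ?thesis .
  qed
  ultimately show thesis
    by (rule that)
qed

text \<open>The root \<open>1\<close> rules out \<open>s = 1\<close>. For \<open>s = -1\<close> the
  root of argument \<open>pi / l\<close> lies in the open right half plane as soon as
  \<open>l\<close> exceeds 2.\<close>

lemma roots_in_left_half_plane_imp:
  fixes s :: real
  assumes "s \<in> {-1, 1}" and "l > 0"
    and left: "\<And>x::complex. x ^ l = of_real s \<Longrightarrow> Re x \<le> 0"
  shows "s = -1" and "l \<le> 2"
proof -
  show s: "s = -1"
    using assms(1) left[of 1] by auto
  show "l \<le> 2"
  proof (rule ccontr)
    assume "\<not> l \<le> 2"
    then have "pi / real l < pi / 2" and "0 < pi / real l"
      by (simp_all add: field_simps)
    then have "cos (pi / real l) > 0"
      by (intro cos_gt_zero_pi) auto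
    moreover have "cis (pi / real l) ^ l = of_real s"
      using \<open>l > 0\<close> s by (simp add: DeMoivre)
    then have "Re (cis (pi / real l)) \<le> 0"
      by (rule left)
    ultimately show False
      by simp
  qed
qed

section \<open>Eigenvalues of a signed permutation matrix\<close>

lemma signed_perm_mat_permutation:
  assumes "signed_perm_mat n P"
  obtains \<pi> where "\<pi> permutes {..<n}"
    and "\<And>i j. i < n \<Longrightarrow> j < n \<Longrightarrow> P $$ (i,j) \<noteq> 0 \<longleftrightarrow> j = \<pi> i"
proof -
  \<comment> \<open>The value \<open>i\<close> outside the index range is what
    \<open>permutes\<close> demands.\<close>
  define \<pi> where "\<pi> i = (if i < n then THE j. j < n \<and> P $$ (i,j) \<noteq> 0 else i)" for i
  have ex1: "\<exists>!j. j < n \<and> P $$ (i,j) \<noteq> 0" if "i < n" for i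
    using assms that by (auto simp: signed_perm_mat_def)
  have col: "\<exists>!i. i < n \<and> P $$ (i,j) \<noteq> 0" if "j < n" for j
    using assms that by (auto simp: signed_perm_mat_def)
  have \<pi>: "\<pi> i < n \<and> P $$ (i, \<pi> i) \<noteq> 0" if "i < n" for i
    using theI'[OF ex1[OF that]] that by (simp add: \<pi>_def)
  have iff: "P $$ (i,j) \<noteq> 0 \<longleftrightarrow> j = \<pi> i" if "i < n" "j < n" for i j
    using \<pi>[OF that(1)] ex1[OF that(1)] that by blast
  have "inj_on \<pi> {..<n}"
  proof (rule inj_onI)
    fix i k assume "i \<in> {..<n}" "k \<in> {..<n}" "\<pi> i = \<pi> k"
    then show "i = k"
      using \<pi>[of i] \<pi>[of k] col[of "\<pi> i"] by auto
  qed
  moreover have "\<pi> ` {..<n} \<subseteq> {..<n}"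
    using \<pi> by auto
  ultimately have "bij_betw \<pi> {..<n} {..<n}"
    by (simp add: bij_betw_def endo_inj_surj)
  then have "\<pi> permutes {..<n}"
    by (rule bij_imp_permutes) (simp add: \<pi>_def)
  then show thesis
    using iff by (rule that)
qed

text \<open>Every cycle of the underlying permutation must have sign -1 and length at most 2. A
  fixed point then gives a diagonal entry -1, and a transposition gives two opposite off-diagonal
  entries; all other entries vanish.\<close>

lemma signed_perm_mat_left_half_plane_imp:
  assumes P: "signed_perm_mat n P"
    and left: "\<And>(x::complex) w. \<exists>i<n. w i \<noteq> 0 \<Longrightarrow>
      \<forall>i<n. (\<Sum>j<n. of_real (P $$ (i,j)) * w j) = x * w i \<Longrightarrow> Re x \<le> 0"
    and "i < n" and "j < n"
  shows "if i = j then P $$ (i,i) \<in> {-1, 0} else P $$ (j,i) = - P $$ (i,j)"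
proof -
  obtain \<pi> where perm: "\<pi> permutes {..<n}"
    and nz: "\<And>i j. i < n \<Longrightarrow> j < n \<Longrightarrow> P $$ (i,j) \<noteq> 0 \<longleftrightarrow> j = \<pi> i"
    using signed_perm_mat_permutation[OF P] by blast
  have \<pi>_less: "\<pi> i < n" if "i < n" for i
    using permutes_in_image[OF perm, of i] that by simp
  define p where "p i = P $$ (i, \<pi> i)" for i
  have p: "p i \<in> {-1, 1}" if "i < n" for i
    using P nz[OF that \<pi>_less[OF that]] \<pi>_less[OF that] that
    by (auto simp: p_def signed_perm_mat_def)
  have mult: "(\<Sum>j<n. of_real (P $$ (i,j)) * w j) = of_real (p i) * w (\<pi> i)"
    if "i < n" for i and w :: "nat \<Rightarrow> complex"
  proof -
    have "(\<Sum>j<n. of_real (P $$ (i,j)) * w j)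
        = (\<Sum>j<n. if j = \<pi> i then of_real (p i) * w (\<pi> i) else 0)"
      using nz[OF that] by (intro sum.cong) (auto simp: p_def)
    then show ?thesis
      using \<pi>_less[OF that] by simp
  qed
  have short: "(\<pi> a = a \<and> p a = -1) \<or> (\<pi> (\<pi> a) = a \<and> p a * p (\<pi> a) = -1)" if "a < n" for a
  proof -
    have "permutation \<pi>"
      unfolding permutation_permutes using perm by blast
    then obtain N where "N > 0" "(\<pi> ^^ N) a = a"
      by (rule permutation_self[of \<pi> a])
    \<comment> \<open>The length of the cycle through \<open>a\<close>; \<open>s\<close> below is
      its sign.\<close>
    define l where "l = (LEAST k. 0 < k \<and> (\<pi> ^^ k) a = a)"
    have l: "0 < l \<and> (\<pi> ^^ l) a = a"
      unfolding l_def by (rule LeastI[of _ N]) (simp add: \<open>N > 0\<close> \<open>(\<pi> ^^ N) a = a\<close>)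
    have minimal: "(\<pi> ^^ k) a \<noteq> a" if "0 < k" "k < l" for k
      using that not_less_Least[of k "\<lambda>k. 0 < k \<and> (\<pi> ^^ k) a = a"] by (auto simp: l_def)
    define s where "s = (\<Prod>t<l. p ((\<pi> ^^ t) a))"
    have iter: "(\<pi> ^^ t) a < n" for t
      by (induction t) (use \<open>a < n\<close> \<pi>_less in auto)
    have "(\<Prod>t<k. p ((\<pi> ^^ t) a)) \<in> {-1, 1}" for k
    proof (induction k)
      case (Suc k)
      then show ?case
        using p[OF iter[of k]] by auto
    qed simp
    then have s: "s \<in> {-1, 1}"
      by (simp add: s_def)
    \<comment> \<open>Each \<open>l\<close>-th root of \<open>s\<close> is an eigenvalue of
      \<open>P\<close>, with an eigenvector normalized at \<open>a\<close>, so \<open>left\<close>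
      applies to it.\<close>
    have "Re x \<le> 0" if root: "x ^ l = of_real s" for x :: complex
    proof -
      have "x \<noteq> 0"
        using root s l by (auto simp: power_0_left)
      moreover have "x ^ l = (\<Prod>t<l. complex_of_real (p ((\<pi> ^^ t) a)))"
        using root by (simp add: s_def)
      ultimately obtain w where "w a = 1" and "\<And>j. of_real (p j) * w (\<pi> j) = x * w j"
        using signed_cycle_eigenvector[of \<pi> l a x "\<lambda>i. of_real (p i)"]
          permutes_inj[OF perm] l minimal by blast
      then show ?thesis
        using \<open>a < n\<close> by (intro left[of w]) (auto simp: mult intro!: exI[of _ a])
    qed
    then have "s = -1" "l \<le> 2"
      using roots_in_left_half_plane_imp[OF s, of l] l by auto
    then consider "l = 1" | "l = 2"
      using l by linarith
    then show ?thesis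
      by cases (use l \<open>s = -1\<close> in \<open>auto simp: s_def numeral_2_eq_2\<close>)
  qed
  show ?thesis
  proof (cases "i = j")
    case True
    then show ?thesis
      using short[OF \<open>i < n\<close>] nz[OF \<open>i < n\<close> \<open>i < n\<close>] p[OF \<open>i < n\<close>] by (auto simp: p_def)
  next
    case False
    \<comment> \<open>Only nonzero entries need an argument: if the entries at \<open>(i,j)\<close>
      and \<open>(j,i)\<close> both vanish, skewness is trivial.\<close>
    have *: "P $$ (b,a) = - P $$ (a,b)" if "a < n" "b < n" "a \<noteq> b" "P $$ (a,b) \<noteq> 0" for a b
    proof -
      have "b = \<pi> a"
        using nz that by blast
      then have "p a * p b = -1" "\<pi> b = a"
        using short[OF \<open>a < n\<close>] \<open>a \<noteq> b\<close> by auto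
      then show ?thesis
        using p[OF \<open>a < n\<close>] p[OF \<open>b < n\<close>] \<open>b = \<pi> a\<close> by (auto simp: p_def)
    qed
    show ?thesis
      using False *[of i j] *[of j i] \<open>i < n\<close> \<open>j < n\<close> by force
  qed
qed

text \<open>The real part of the quadratic form of \<open>P\<close> at \<open>w\<close> is
  \<open>Re x\<close> times the squared norm of \<open>w\<close>. It sees only the symmetric part of
  \<open>P\<close>, which is diagonal and nonpositive.\<close>

lemma Re_eigenvalue_nonpos:
  fixes P :: "nat \<Rightarrow> nat \<Rightarrow> real" and w :: "nat \<Rightarrow> complex"
  assumes skew: "\<And>i j. i < n \<Longrightarrow> j < n \<Longrightarrow> i \<noteq> j \<Longrightarrow> P j i = - P i j"
    and diag: "\<And>i. i < n \<Longrightarrow> P i i \<le> 0"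
    and eig: "\<And>i. i < n \<Longrightarrow> (\<Sum>j<n. of_real (P i j) * w j) = x * w i"
    and "k < n" and "w k \<noteq> 0"
  shows "Re x \<le> 0"
proof -
  define g where "g i j = Re (cnj (w i) * w j)" for i j
  have sym: "g i j = g j i" for i j
    by (simp add: g_def)
  define N where "N = (\<Sum>i<n. (cmod (w i))\<^sup>2)"
  have "N > 0"
    unfolding N_def using \<open>k < n\<close> \<open>w k \<noteq> 0\<close> by (intro sum_pos2[of _ k]) auto
  have "(\<Sum>i<n. cnj (w i) * (x * w i)) = x * of_real N"
    by (simp add: N_def sum_distrib_left complex_norm_square mult_ac
        del: of_real_power)
  then have "Re x * N = Re (\<Sum>i<n. cnj (w i) * (x * w i))"
    by simp
  also have "\<dots> = Re (\<Sum>i<n. cnj (w i) * (\<Sum>j<n. of_real (P i j) * w j))"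
    using eig by simp
  also have "\<dots> = (\<Sum>i<n. \<Sum>j<n. P i j * g i j)"
    by (simp add: g_def sum_distrib_left algebra_simps)
  finally have S: "Re x * N = (\<Sum>i<n. \<Sum>j<n. P i j * g i j)" .
  \<comment> \<open>As \<open>g\<close> is symmetric, \<open>P\<close> may be replaced by its
    transpose; adding both forms cancels the skew part.\<close>
  also have "\<dots> = (\<Sum>i<n. \<Sum>j<n. P j i * g i j)"
    by (subst sum.swap) (simp add: sym)
  finally have "2 * (Re x * N) = (\<Sum>i<n. \<Sum>j<n. (P i j + P j i) * g i j)"
    using S by (simp add: sum.distrib distrib_right)
  also have "\<dots> \<le> 0"
  proof (intro sum_nonpos)
    fix i j assume "i \<in> {..<n}" "j \<in> {..<n}"
    then show "(P i j + P j i) * g i j \<le> 0"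
      using skew[of i j] diag[of i]
      by (cases "i = j") (auto simp: g_def intro!: mult_nonpos_nonneg)
  qed
  finally show ?thesis
    using \<open>N > 0\<close> by (simp add: mult_le_0_iff)
qed

section \<open>Stability at wavenumber zero\<close>

text \<open>At wavenumber zero the matrix is block diagonal, with the scalar block
  \<open>\<alpha> 0 - \<i> * \<omega>\<close> and a block that is singular iff
  \<open>- \<i> * \<omega> * \<tau>\<close> is an eigenvalue of \<open>P\<close>. Kernel vectors are
  split into component 0 and the rest.\<close>

lemma dispersion_relation_zero_iff:
  fixes n :: nat and \<tau> :: real and \<omega> :: complex
  defines "m \<equiv> Suc n"
  shows "det (- (\<i> * \<omega>) \<cdot>\<^sub>m cmat (D_mat m \<tau>) - cmat (B_hat m \<alpha> P)) = 0 \<longleftrightarrow>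
    \<i> * \<omega> = of_real (\<alpha> 0) \<or>
    (\<exists>w. (\<exists>i<n. w i \<noteq> 0) \<and>
      (\<forall>i<n. (\<Sum>j<n. of_real (P $$ (i,j)) * w j) = - (\<i> * \<omega>) * of_real \<tau> * w i))"
    (is "det ?M = 0 \<longleftrightarrow> ?scalar \<or> ?block")
proof -
  have M: "?M \<in> carrier_mat m m"
    by (rule carrier_matI) (simp_all add: cmat_def D_mat_def B_hat_def)
  have row: "(?M *\<^sub>v v) $ i = (\<Sum>j<Suc n.
      (- (\<i> * \<omega>) * of_real (D_mat m \<tau> $$ (i,j)) - of_real (B_hat m \<alpha> P $$ (i,j))) * v $ j)"
    if "v \<in> carrier_vec m" "i < m" for v i
    using that M
    by (simp add: scalar_prod_def cmat_def D_mat_def B_hat_def m_def atLeast0LessThan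
        del: sum.lessThan_Suc)
  have row0: "(?M *\<^sub>v v) $ 0 = (of_real (\<alpha> 0) - \<i> * \<omega>) * v $ 0" if "v \<in> carrier_vec m" for v
    by (subst row[OF that], simp add: m_def, subst sum.lessThan_Suc_shift)
      (simp add: m_def D_mat_def B_hat_def)
  have rowS: "(?M *\<^sub>v v) $ Suc i
      = - (\<i> * \<omega>) * of_real \<tau> * v $ Suc i - (\<Sum>j<n. of_real (P $$ (i,j)) * v $ Suc j)"
    if "v \<in> carrier_vec m" "i < n" for v i
  proof -
    have "(?M *\<^sub>v v) $ Suc i = (\<Sum>j<n. (if i = j then - (\<i> * \<omega>) * of_real \<tau> * v $ Suc i else 0)
        - of_real (P $$ (i,j)) * v $ Suc j)"
      by (subst row[OF that(1)], use that in \<open>simp add: m_def\<close>, subst sum.lessThan_Suc_shift)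
        (use that in \<open>auto intro!: sum.cong simp: m_def D_mat_def B_hat_def algebra_simps\<close>)
    then show ?thesis
      using that by (simp add: sum_subtractf)
  qed
  have zero_iff: "v = 0\<^sub>v m \<longleftrightarrow> v $ 0 = 0 \<and> (\<forall>i<n. v $ Suc i = 0)" if "v \<in> carrier_vec m" for v
    using that by (auto simp: m_def vec_eq_iff less_Suc_eq_0_disj)
  have kernel_iff: "?M *\<^sub>v v = 0\<^sub>v m \<longleftrightarrow> (of_real (\<alpha> 0) - \<i> * \<omega>) * v $ 0 = 0 \<and>
      (\<forall>i<n. (\<Sum>j<n. of_real (P $$ (i,j)) * v $ Suc j) = - (\<i> * \<omega>) * of_real \<tau> * v $ Suc i)"
    if "v \<in> carrier_vec m" for v
    using M that by (subst zero_iff) (auto simp: row0 rowS)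
  have "det ?M = 0 \<longleftrightarrow> (\<exists>v. v \<in> carrier_vec m \<and> v \<noteq> 0\<^sub>v m \<and> ?M *\<^sub>v v = 0\<^sub>v m)"
    using det_0_iff_vec_prod_zero[OF M] .
  also have "\<dots> \<longleftrightarrow> ?scalar \<or> ?block"
  proof
    assume "\<exists>v. v \<in> carrier_vec m \<and> v \<noteq> 0\<^sub>v m \<and> ?M *\<^sub>v v = 0\<^sub>v m"
    then obtain v where v: "v \<in> carrier_vec m" "v \<noteq> 0\<^sub>v m" "?M *\<^sub>v v = 0\<^sub>v m"
      by blast
    show "?scalar \<or> ?block"
    proof (cases "v $ 0 = 0")
      case True
      then have ?block
        using v kernel_iff[of v] zero_iff[of v] by (intro exI[of _ "\<lambda>i. v $ Suc i"]) auto
      then show ?thesis ..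
    next
      case False
      then show ?thesis
        using v kernel_iff[of v] by auto
    qed
  next
    assume "?scalar \<or> ?block"
    then show "\<exists>v. v \<in> carrier_vec m \<and> v \<noteq> 0\<^sub>v m \<and> ?M *\<^sub>v v = 0\<^sub>v m"
    proof
      assume ?scalar
      define v :: "complex vec" where "v = vec m (\<lambda>i. if i = 0 then 1 else 0)"
      have v: "v \<in> carrier_vec m" "v $ 0 = 1" "\<And>i. i < n \<Longrightarrow> v $ Suc i = 0"
        by (simp_all add: v_def m_def)
      then show ?thesis
        using \<open>?scalar\<close> kernel_iff[OF v(1)] zero_iff[OF v(1)] by (intro exI[of _ v]) simp
    next
      assume ?block
      then obtain w where w: "\<exists>i<n. w i \<noteq> 0"
        "\<forall>i<n. (\<Sum>j<n. of_real (P $$ (i,j)) * w j) = - (\<i> * \<omega>) * of_real \<tau> * w i"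
        by blast
      define v where "v = vec m (\<lambda>i. if i = 0 then 0 else w (i - 1))"
      have v: "v \<in> carrier_vec m" "v $ 0 = 0" "\<And>i. i < n \<Longrightarrow> v $ Suc i = w i"
        by (simp_all add: v_def m_def)
      then show ?thesis
        using w kernel_iff[OF v(1)] zero_iff[OF v(1)] by (intro exI[of _ v]) simp
    qed
  qed
  finally show ?thesis .
qed

text \<open>Under the substitution \<open>x = - \<i> * \<omega> * \<tau>\<close> the real part of
  \<open>x\<close> is \<open>\<tau> * Im \<omega>\<close>. The scalar block contributes only
  \<open>\<omega> = - \<i> * \<alpha> 0\<close>, which is stable.\<close>

lemma stable_at_zero_iff:
  fixes n :: nat and \<tau> :: real
  assumes "\<tau> > 0" and "\<alpha> 0 \<ge> 0"
  shows "(\<forall>\<omega>::complex. det (- (\<i> * \<omega>) \<cdot>\<^sub>m cmat (D_mat (Suc n) \<tau>) - cmat (B_hat (Suc n) \<alpha> P)) = 0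
      \<longrightarrow> Im \<omega> \<le> 0) \<longleftrightarrow>
    (\<forall>(x::complex) w. (\<exists>i<n. w i \<noteq> 0) \<longrightarrow>
      (\<forall>i<n. (\<Sum>j<n. of_real (P $$ (i,j)) * w j) = x * w i) \<longrightarrow> Re x \<le> 0)"
    (is "?stable \<longleftrightarrow> ?left")
proof
  assume stable: ?stable
  show ?left
  proof (intro allI impI)
    fix x :: complex and w :: "nat \<Rightarrow> complex"
    assume w: "\<exists>i<n. w i \<noteq> 0" "\<forall>i<n. (\<Sum>j<n. of_real (P $$ (i,j)) * w j) = x * w i"
    define \<omega> where "\<omega> = \<i> * x / of_real \<tau>"
    have "- (\<i> * \<omega>) * of_real \<tau> = x"
      using \<open>\<tau> > 0\<close> by (simp add: \<omega>_def)
    then have "det (- (\<i> * \<omega>) \<cdot>\<^sub>m cmat (D_mat (Suc n) \<tau>) - cmat (B_hat (Suc n) \<alpha> P)) = 0"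
      unfolding dispersion_relation_zero_iff using w by (intro disjI2 exI[of _ w]) simp
    then have "Im \<omega> \<le> 0"
      using stable by blast
    then show "Re x \<le> 0"
      using \<open>\<tau> > 0\<close> by (simp add: \<omega>_def divide_le_0_iff)
  qed
next
  assume left: ?left
  show ?stable
    unfolding dispersion_relation_zero_iff
  proof (intro allI impI, elim disjE exE conjE)
    fix \<omega> :: complex
    assume "\<i> * \<omega> = of_real (\<alpha> 0)"
    then have "Re (\<i> * \<omega>) = \<alpha> 0"
      by simp
    then show "Im \<omega> \<le> 0"
      using \<open>\<alpha> 0 \<ge> 0\<close> by simp
  next
    fix \<omega> :: complex and w i
    assume "\<forall>i<n. (\<Sum>j<n. of_real (P $$ (i,j)) * w j) = - (\<i> * \<omega>) * of_real \<tau> * w i"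
      and "i < n" "w i \<noteq> 0"
    then have "Re (- (\<i> * \<omega>) * of_real \<tau>) \<le> 0"
      using left by blast
    then show "Im \<omega> \<le> 0"
      using \<open>\<tau> > 0\<close> by (simp add: mult_le_0_iff)
  qed
qed

text \<open>A skew-symmetric \<open>R\<close> has zero diagonal, so the decomposition is forced:
  \<open>E\<close> is minus the diagonal of \<open>P\<close>, and \<open>R\<close> is the
  off-diagonal part.\<close>

lemma skew_minus_diagonal_iff:
  fixes P :: "real mat"
  assumes P: "P \<in> carrier_mat n n"
  shows "(\<exists>R E. R \<in> carrier_mat n n \<and> E \<in> carrier_mat n n \<and> transpose_mat R = - R
      \<and> (\<forall>i<n. \<forall>j<n. i \<noteq> j \<longrightarrow> E $$ (i,j) = 0) \<and> (\<forall>i<n. E $$ (i,i) \<in> {0, 1}) \<and> P = R - E)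
    \<longleftrightarrow> (\<forall>i<n. \<forall>j<n. if i = j then P $$ (i,i) \<in> {-1, 0} else P $$ (j,i) = - P $$ (i,j))"
    (is "?decomp \<longleftrightarrow> ?entries")
proof
  assume ?decomp
  then obtain R E where R: "R \<in> carrier_mat n n" and E: "E \<in> carrier_mat n n"
    and skew: "transpose_mat R = - R"
    and off: "\<forall>i<n. \<forall>j<n. i \<noteq> j \<longrightarrow> E $$ (i,j) = 0"
    and diag: "\<forall>i<n. E $$ (i,i) \<in> {0, 1}" and PRE: "P = R - E"
    by blast
  have R_skew: "R $$ (j,i) = - R $$ (i,j)" if "i < n" "j < n" for i j
    using arg_cong[OF skew, of "\<lambda>A. A $$ (i,j)"] R that by simp
  show ?entries
  proof (intro allI impI)
    fix i j assume "i < n" "j < n"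
    moreover from this have "P $$ (i,j) = R $$ (i,j) - E $$ (i,j)" "P $$ (j,i) = R $$ (j,i) - E $$ (j,i)"
      using E unfolding PRE by auto
    ultimately show "if i = j then P $$ (i,i) \<in> {-1, 0} else P $$ (j,i) = - P $$ (i,j)"
      using R_skew[of i j] off diag by auto
  qed
next
  assume entries: ?entries
  define R where "R = mat n n (\<lambda>(i,j). if i = j then 0 else P $$ (i,j))"
  define E where "E = mat n n (\<lambda>(i,j). if i = j then - P $$ (i,i) else 0)"
  have "transpose_mat R = - R"
  proof (rule eq_matI)
    fix i j assume "i < dim_row (- R)" "j < dim_col (- R)"
    then have "i < n" "j < n"
      by (simp_all add: R_def)
    then show "transpose_mat R $$ (i,j) = (- R) $$ (i,j)"
      using entries[rule_format, of i j] by (simp add: R_def split: if_splits)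
  qed (simp_all add: R_def)
  moreover have "P = R - E"
    by (rule eq_matI) (use P in \<open>auto simp: R_def E_def\<close>)
  moreover have "\<forall>i<n. E $$ (i,i) \<in> {0, 1}"
  proof (intro allI impI)
    fix i assume "i < n"
    then show "E $$ (i,i) \<in> {0, 1}"
      using entries[rule_format, of i i] by (auto simp: E_def)
  qed
  moreover have "R \<in> carrier_mat n n" "E \<in> carrier_mat n n"
    "\<forall>i<n. \<forall>j<n. i \<noteq> j \<longrightarrow> E $$ (i,j) = 0"
    by (auto simp: R_def E_def)
  ultimately show ?decomp
    by blast
qed

section \<open>Stability for large wavenumbers\<close>

text \<open>A nonreal root would come with its conjugate; their product, the positive number
  \<open>(cmod z)\<^sup>2\<close>, would equal \<open>- c\<close>.\<close>

lemma root_monic_quadratic_real: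
  fixes z :: complex and b c :: real
  assumes z: "z\<^sup>2 = of_real b * z + of_real c" and "c \<ge> 0"
  shows "z \<in> \<real>"
proof (rule ccontr)
  assume "z \<notin> \<real>"
  then have "Im z \<noteq> 0"
    by (simp add: complex_is_Real_iff)
  have "Re z * Re z - Im z * Im z = b * Re z + c"
    using arg_cong[OF z, of Re] by (simp add: power2_eq_square)
  moreover have "2 * Re z * Im z = b * Im z"
    using arg_cong[OF z, of Im] by (simp add: power2_eq_square)
  with \<open>Im z \<noteq> 0\<close> have "b = 2 * Re z"
    by simp
  ultimately have "(Re z)\<^sup>2 + (Im z)\<^sup>2 + c = 0"
    by (simp add: power2_eq_square)
  moreover have "(Im z)\<^sup>2 > 0"
    using \<open>Im z \<noteq> 0\<close> by simp
  ultimately show False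
    using \<open>c \<ge> 0\<close> zero_le_power2[of "Re z"] by linarith
qed

text \<open>Of the coefficients \<open>a\<close>, only \<open>a 1\<close> can affect the spectrum:
  the later ones multiply inner components, and if one of these is nonzero the pairing alone gives
  \<open>z\<^sup>2 = 1\<close>.\<close>

lemma eigenvalue_A_hat_P_star_real:
  fixes z :: complex
  assumes "m \<ge> 2" and \<sigma>: "\<sigma> \<in> {-1, 1}"
    and "eigenvalue (cmat (A_hat m \<sigma> a (P_star m \<sigma>))) z"
  shows "z \<in> \<real>"
proof -
  let ?A = "cmat (A_hat m \<sigma> a (P_star m \<sigma>))"
  have A: "?A \<in> carrier_mat m m"
    by (simp add: cmat_def A_hat_def)
  obtain v where v: "v \<in> carrier_vec m" "v \<noteq> 0\<^sub>v m" and eig: "?A *\<^sub>v v = z \<cdot>\<^sub>v v"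
    using assms(3) A by (auto simp: eigenvalue_def eigenvector_def)
  have eig_row: "(\<Sum>j<m. ?A $$ (i,j) * v $ j) = z * v $ i" if "i < m" for i
    using arg_cong[OF eig, of "\<lambda>u. u $ i"] A v that
    by (simp add: scalar_prod_def atLeast0LessThan)
  \<comment> \<open>The only nonzero entry of row \<open>i > 0\<close>. With 1-based indices it sits
    in column \<open>m - i\<close> of \<open>P_star\<close>, hence in the 0-based column
    \<open>m - 1 - i\<close> here.\<close>
  define p :: "nat \<Rightarrow> real" where
    "p i = (if 2 * (m - i) \<le> m then \<sigma> * (-1) ^ (m - i - 1) else \<sigma> * (-1) ^ i)" for i
  have rowS: "of_real (p i) * v $ (m - 1 - i) = z * v $ i" if "0 < i" "i < m" for i
  proof -
    have "?A $$ (i,j) = (if j = m - 1 - i then of_real (p i) else 0)" if "j < m" for j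
      using \<open>0 < i\<close> \<open>i < m\<close> that
      by (auto simp: cmat_def A_hat_def P_star_def Let_def p_def)
    then have "(\<Sum>j<m. ?A $$ (i,j) * v $ j)
        = (\<Sum>j<m. if j = m - 1 - i then of_real (p i) * v $ (m - 1 - i) else 0)"
      by (intro sum.cong) auto
    then show ?thesis
      using eig_row[of i] that by simp
  qed
  show ?thesis
  proof (cases "\<exists>i. 0 < i \<and> i < m - 1 \<and> v $ i \<noteq> 0")
    case True
    then obtain i where i: "0 < i" "i < m - 1" "v $ i \<noteq> 0"
      by blast
    have "p i * p (m - 1 - i) = 1"
    proof -
      \<comment> \<open>In both branches the exponent in \<open>p i\<close> is the minimum of
        \<open>i\<close> and \<open>m - 1 - i\<close>, so \<open>p\<close> is invariant under the
        reflection of indices. The case \<open>j = i + 1\<close> is the self-paired middle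
        index.\<close>
      define j where "j = m - i"
      have ij: "m = i + j" "m - 1 - i = j - 1" "m - (j - 1) = i + 1"
        using i by (auto simp: j_def)
      have "p i = (if 2 * j \<le> m then \<sigma> * (-1) ^ (j - 1) else \<sigma> * (-1) ^ i)"
        by (simp add: p_def j_def)
      moreover have "p (j - 1) = (if 2 * (i + 1) \<le> m then \<sigma> * (-1) ^ i else \<sigma> * (-1) ^ (j - 1))"
        unfolding p_def ij(3) by simp
      moreover have "j \<le> i \<or> j = i + 1 \<or> i + 1 < j"
        by linarith
      ultimately have "p (m - 1 - i) = p i"
        unfolding ij(2) by (auto simp: ij(1))
      moreover have "p i * p i = 1"
        using \<sigma> by (auto simp: p_def minus_one_power_iff)
      ultimately show ?thesis
        by simp
    qed
    then have pp: "complex_of_real (p i) * of_real (p (m - 1 - i)) = 1"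
      by (metis of_real_1 of_real_mult)
    \<comment> \<open>Going to the partner index and back returns to \<open>v $ i\<close>.\<close>
    have "z\<^sup>2 * v $ i = of_real (p i) * (z * v $ (m - 1 - i))"
      using rowS[of i] i by (simp add: power2_eq_square mult_ac)
    also have "\<dots> = of_real (p i) * of_real (p (m - 1 - i)) * v $ i"
      using rowS[of "m - 1 - i"] i by simp
    finally have "z\<^sup>2 = of_real 0 * z + of_real 1"
      using \<open>v $ i \<noteq> 0\<close> pp by simp
    then show ?thesis
      by (rule root_monic_quadratic_real) simp
  next
    case False
    have inner: "v $ j = 0" if "j \<in> {..<m} - {0, m - 1}" for j
    proof -
      have "0 < j" "j < m - 1"
        using that by auto
      with False show ?thesis
        by blast
    qed
    have "(\<Sum>j<m. ?A $$ (0,j) * v $ j) = (\<Sum>j\<in>{0, m - 1}. ?A $$ (0,j) * v $ j)"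
      using \<open>m \<ge> 2\<close> by (intro sum.mono_neutral_right) (auto simp: inner)
    also have "\<dots> = ?A $$ (0,0) * v $ 0 + ?A $$ (0, m - 1) * v $ (m - 1)"
      using \<open>m \<ge> 2\<close> by (subst sum.insert) auto
    also have "?A $$ (0,0) = of_real (a 1)"
      using \<open>m \<ge> 2\<close> by (simp add: cmat_def A_hat_def)
    also have "?A $$ (0, m - 1) = of_real \<sigma>"
      using \<open>m \<ge> 2\<close> by (simp add: cmat_def A_hat_def)
    finally have row0: "of_real (a 1) * v $ 0 + of_real \<sigma> * v $ (m - 1) = z * v $ 0"
      using eig_row[of 0] \<open>m \<ge> 2\<close> by simp
    \<comment> \<open>Row \<open>m - 1\<close> pairs the last component with component 0; the
      exponent there is zero. With \<open>row0\<close> this leaves a closed system in two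
      unknowns.\<close>
    have last: "of_real \<sigma> * v $ 0 = z * v $ (m - 1)"
      using rowS[of "m - 1"] \<open>m \<ge> 2\<close> by (simp add: p_def)
    have "v $ 0 \<noteq> 0"
    proof
      assume "v $ 0 = 0"
      with row0 \<sigma> have "v $ (m - 1) = 0"
        by auto
      have "v $ i = 0" if "i < m" for i
        using inner[of i] that \<open>v $ 0 = 0\<close> \<open>v $ (m - 1) = 0\<close> by blast
      then have "v = 0\<^sub>v m"
        using v by (intro eq_vecI) auto
      with v show False
        by simp
    qed
    have "z\<^sup>2 * v $ 0 = of_real (a 1) * z * v $ 0 + of_real \<sigma> * (z * v $ (m - 1))"
      using arg_cong[OF row0, of "\<lambda>u. z * u"] by (simp add: power2_eq_square algebra_simps)
    \<comment> \<open>The constant term is the square of \<open>\<sigma>\<close>, hence 1 for either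
      sign.\<close>
    also have "\<dots> = (of_real (a 1) * z + of_real 1) * v $ 0"
      using \<sigma> unfolding last[symmetric] by (auto simp: algebra_simps)
    finally have "z\<^sup>2 = of_real (a 1) * z + of_real 1"
      using \<open>v $ 0 \<noteq> 0\<close> by simp
    then show ?thesis
      by (rule root_monic_quadratic_real) simp
  qed
qed

theorem theorem2:
  fixes m :: nat and \<sigma>0 \<tau> :: real and \<alpha> :: "nat \<Rightarrow> real" and P :: "real mat"
  assumes "m \<ge> 2" and "\<sigma>0 \<in> {-1, 1}" and "\<tau> > 0" and "\<alpha> 0 \<ge> 0"
    and "signed_perm_mat (m - 1) P"
  shows "((\<forall>\<omega>::complex.
             det (- (\<i> * \<omega>) \<cdot>\<^sub>m cmat (D_mat m \<tau>) - cmat (B_hat m \<alpha> P)) = 0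
             \<longrightarrow> Im \<omega> \<le> 0)
          \<longleftrightarrow> (\<exists>R E. R \<in> carrier_mat (m-1) (m-1) \<and> E \<in> carrier_mat (m-1) (m-1)
                  \<and> transpose_mat R = - R
                  \<and> (\<forall>i<m-1. \<forall>j<m-1. i \<noteq> j \<longrightarrow> E $$ (i,j) = 0)
                  \<and> (\<forall>i<m-1. E $$ (i,i) \<in> {0, 1})
                  \<and> P = R - E))
       \<and> (P = P_star m \<sigma>0 \<longrightarrow>
           (\<forall>a :: nat \<Rightarrow> real. \<forall>z::complex.
              eigenvalue (cmat (A_hat m \<sigma>0 a P)) z \<longrightarrow> z \<in> \<real>))"
    (is "(?stable \<longleftrightarrow> ?decomp) \<and> ?large")
proof
  define n where "n = m - 1"
  have m: "m = Suc n"
    using \<open>m \<ge> 2\<close> by (simp add: n_def)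
  have sp: "signed_perm_mat n P"
    using assms(5) by (simp add: n_def)
  then have P: "P \<in> carrier_mat n n"
    by (simp add: signed_perm_mat_def)
  let ?left = "\<forall>(x::complex) w. (\<exists>i<n. w i \<noteq> 0) \<longrightarrow>
    (\<forall>i<n. (\<Sum>j<n. of_real (P $$ (i,j)) * w j) = x * w i) \<longrightarrow> Re x \<le> 0"
  let ?entries = "\<forall>i<n. \<forall>j<n. if i = j then P $$ (i,i) \<in> {-1, 0} else P $$ (j,i) = - P $$ (i,j)"
  have "?stable \<longleftrightarrow> ?left"
    unfolding m by (rule stable_at_zero_iff) fact+
  also have "\<dots> \<longleftrightarrow> ?entries"
  proof
    assume ?left
    then show ?entries
      using signed_perm_mat_left_half_plane_imp[OF sp] by blast
  next
    assume entries: ?entries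
    show ?left
    proof (intro allI impI, elim exE conjE)
      fix x :: complex and w i
      assume eig: "\<forall>i<n. (\<Sum>j<n. of_real (P $$ (i,j)) * w j) = x * w i" and "i < n" "w i \<noteq> 0"
      show "Re x \<le> 0"
      proof (rule Re_eigenvalue_nonpos[of n "\<lambda>i j. P $$ (i,j)" w x i])
        show "P $$ (j,i) = - P $$ (i,j)" if "i < n" "j < n" "i \<noteq> j" for i j
          using entries[rule_format, OF that(1,2)] that(3) by simp
        show "P $$ (i,i) \<le> 0" if "i < n" for i
          using entries[rule_format, OF that that] by auto
      qed (use eig \<open>i < n\<close> \<open>w i \<noteq> 0\<close> in auto)
    qed
  qed
  also have "\<dots> \<longleftrightarrow> ?decomp"
    unfolding n_def[symmetric] by (rule skew_minus_diagonal_iff[OF P, symmetric])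
  finally show "?stable \<longleftrightarrow> ?decomp" .
  show ?large
    using eigenvalue_A_hat_P_star_real[OF assms(1,2)] by blast
qed

end
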